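(* Let $n\ge 2$ be an integer. The path $P_n$ of order $n$ is an SR-graph if and only if $n=3$, or $n\geq 4$ and $n\equiv 1 \pmod 3$.
   Context: $\gamma(G)$ denotes the domination number of a finite simple graph $G$ (minimum cardinality of a set $X\subseteq V(G)$ such that every vertex is in $X$ or adjacent to a vertex of $X$). For an edge $e=uv$ of $G$, $G-e$ is the graph obtained by deleting $e$, and $G_e$ is the graph obtained by subdividing $e$: delete $e$, add a new vertex $w$ and the edges $uw$ and $wv$. A finite connected simple graph $G$ of order at least two is an SR-graph (sub-removable graph) if $\gamma(G-e)=\gamma(G_e)$ for every edge $e$ of $G$. *)

theory Defs
  imports "Graph_Theory.Graph_Theory" "HOL-Number_Theory.Cong"
begin

text \<open>
  A finite simple graph is a \<^locale>\<open>pair_graph\<close>: finite vertex set, no loops, and a symmetric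
  arc set, so that each undirected edge \<open>uv\<close> is represented by the two arcs \<open>(u, v)\<close> and \<open>(v, u)\<close>.
\<close>

definition dominating_set :: "'a pair_pre_digraph \<Rightarrow> 'a set \<Rightarrow> bool" where
  "dominating_set G X \<longleftrightarrow>
     X \<subseteq> pverts G \<and> (\<forall>v\<in>pverts G. v \<in> X \<or> (\<exists>x\<in>X. (x, v) \<in> parcs G))"

definition domination_number :: "'a pair_pre_digraph \<Rightarrow> nat" where
  "domination_number G = (LEAST k. \<exists>X. dominating_set G X \<and> card X = k)"

definition delete_edge :: "'a pair_pre_digraph \<Rightarrow> 'a \<times> 'a \<Rightarrow> 'a pair_pre_digraph" where
  "delete_edge G e = \<lparr> pverts = pverts G, parcs = parcs G - {e, prod.swap e} \<rparr>"

text \<open>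
  The library operation \<^const>\<open>subdivide\<close> takes the new vertex as an argument, which has to lie
  outside the graph. To have such a vertex over every vertex type, the graph is
  first copied along \<^const>\<open>Some\<close>; the new vertex is then \<^const>\<open>None\<close>.
\<close>

definition subdivide_edge ::
    "'a pair_pre_digraph \<Rightarrow> 'a \<times> 'a \<Rightarrow> 'a option pair_pre_digraph" where
  "subdivide_edge G e =
     subdivide \<lparr> pverts = Some ` pverts G, parcs = map_prod Some Some ` parcs G \<rparr>
       (map_prod Some Some e) None"

definition SR_graph :: "'a pair_pre_digraph \<Rightarrow> bool" where
  "SR_graph G \<longleftrightarrow>
     pair_graph G \<and> Digraph_Component.connected (with_proj G) \<and> 2 \<le> card (pverts G) \<and>
     (\<forall>e\<in>parcs G. domination_number (delete_edge G e) = domination_number (subdivide_edge G e))"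

definition path_graph :: "nat \<Rightarrow> nat pair_pre_digraph" where
  "path_graph n =
     \<lparr> pverts = {..<n}, parcs = {(i, j). i < n \<and> j < n \<and> (j = Suc i \<or> i = Suc j)} \<rparr>"

end

theory Submission
  imports Defs
begin

text \<open>
  Since a vertex of a path dominates at most three vertices, \<open>P\<^sub>n\<close> has domination number
  \<open>\<lceil>n/3\<rceil> = (n + 2) div 3\<close>. Deleting the edge between the vertices \<open>i\<close> and \<open>i + 1\<close> leaves disjoint
  copies of the paths of orders \<open>i + 1\<close> and \<open>n - i - 1\<close>, and subdividing any edge gives the path of
  order \<open>n + 1\<close>. So the claim is about when \<open>\<lceil>a/3\<rceil> + \<lceil>b/3\<rceil> = \<lceil>(n+1)/3\<rceil>\<close> for all
  \<open>a, b \<ge> 1\<close> with \<open>a + b = n\<close>. For \<open>n \<equiv> 1\<close> it always holds; it fails for \<open>a = 1\<close> if \<open>n \<equiv> 2\<close> and for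
  \<open>a = 3\<close> if \<open>n \<equiv> 0\<close>, where the latter needs \<open>n > 3\<close>.
\<close>

section \<open>Domination numbers under isomorphism and disjoint union\<close>

lemma domination_number_le:
  assumes "dominating_set G X"
  shows "domination_number G \<le> card X"
  unfolding domination_number_def using assms by (blast intro: Least_le)

lemma obtain_minimum_dominating_set:
  obtains X where "dominating_set G X" "card X = domination_number G"
proof -
  have "dominating_set G (pverts G)"
    by (simp add: dominating_set_def)
  then have "\<exists>k X. dominating_set G X \<and> card X = k"
    by blast
  from LeastI_ex[OF this] that show ?thesis
    unfolding domination_number_def by blast
qed

text \<open>A bijection that preserves arcs in one direction already carries dominating sets forward
  without changing their size. An isomorphism then gives equality by using this for the map and for
  its inverse.\<close>

lemma domination_number_le_of_bij:
  assumes bij: "bij_betw f (pverts G) (pverts H)"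
    and arcs: "\<And>u v. u \<in> pverts G \<Longrightarrow> v \<in> pverts G \<Longrightarrow> (u, v) \<in> parcs G \<Longrightarrow> (f u, f v) \<in> parcs H"
  shows "domination_number H \<le> domination_number G"
proof -
  obtain X where X: "dominating_set G X" "card X = domination_number G"
    by (rule obtain_minimum_dominating_set)
  have X_sub: "X \<subseteq> pverts G"
    using X(1) by (simp add: dominating_set_def)
  have "dominating_set H (f ` X)"
    unfolding dominating_set_def
  proof (intro conjI ballI)
    show "f ` X \<subseteq> pverts H"
      using bij X_sub by (auto simp: bij_betw_def)
  next
    fix w
    assume "w \<in> pverts H"
    then obtain v where v: "v \<in> pverts G" "w = f v"
      using bij by (auto simp: bij_betw_def)
    with X(1) have "v \<in> X \<or> (\<exists>x\<in>X. (x, v) \<in> parcs G)"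
      by (simp add: dominating_set_def)
    with v X_sub arcs show "w \<in> f ` X \<or> (\<exists>x\<in>f ` X. (x, w) \<in> parcs H)"
      by blast
  qed
  then have "domination_number H \<le> card (f ` X)"
    by (rule domination_number_le)
  also have "card (f ` X) = card X"
    using bij X_sub by (auto simp: bij_betw_def intro: card_image inj_on_subset)
  finally show ?thesis
    using X(2) by simp
qed

lemma domination_number_iso:
  assumes bij: "bij_betw f (pverts G) (pverts H)"
    and arcs: "\<And>u v. u \<in> pverts G \<Longrightarrow> v \<in> pverts G \<Longrightarrow>
      (f u, f v) \<in> parcs H \<longleftrightarrow> (u, v) \<in> parcs G"
  shows "domination_number G = domination_number H"
proof (rule antisym)
  have inv: "inv_into (pverts G) f w \<in> pverts G" "f (inv_into (pverts G) f w) = w"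
    if "w \<in> pverts H" for w
    using bij that by (auto simp: bij_betw_def inv_into_into f_inv_into_f)
  show "domination_number G \<le> domination_number H"
    using bij_betw_inv_into[OF bij] by (rule domination_number_le_of_bij) (metis arcs inv)
  show "domination_number H \<le> domination_number G"
    using bij by (rule domination_number_le_of_bij) (simp add: arcs)
qed

lemma domination_number_disjoint_union:
  assumes verts: "pverts G = pverts H \<union> pverts K"
    and arcs: "parcs G = parcs H \<union> parcs K"
    and disj: "pverts H \<inter> pverts K = {}"
    and fin: "finite (pverts G)"
    and H: "pair_wf_digraph H"
    and K: "pair_wf_digraph K"
  shows "domination_number G = domination_number H + domination_number K"
proof (rule antisym)
  obtain X where X: "dominating_set H X" "card X = domination_number H"
    by (rule obtain_minimum_dominating_set)
  obtain Y where Y: "dominating_set K Y" "card Y = domination_number K"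
    by (rule obtain_minimum_dominating_set)
  have "dominating_set G (X \<union> Y)"
    using X(1) Y(1) by (auto simp: dominating_set_def verts arcs)
  then have "domination_number G \<le> card (X \<union> Y)"
    by (rule domination_number_le)
  also have "\<dots> \<le> card X + card Y"
    by (rule card_Un_le)
  finally show "domination_number G \<le> domination_number H + domination_number K"
    using X(2) Y(2) by simp
next
  interpret H: pair_wf_digraph H by (rule H)
  interpret K: pair_wf_digraph K by (rule K)
  obtain Z where Z: "dominating_set G Z" "card Z = domination_number G"
    by (rule obtain_minimum_dominating_set)
  \<comment> \<open>A vertex of \<open>H\<close> outside \<open>Z\<close> has a neighbour in
    \<open>Z\<close>. The arc joining them cannot come from \<open>K\<close>, since its head would
    lie in \<open>K\<close>; so it is an arc of \<open>H\<close> and the neighbour lies in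
    \<open>H\<close>.\<close>
  have "dominating_set H (Z \<inter> pverts H)"
    using Z(1) disj unfolding dominating_set_def verts arcs
    by (blast dest: H.in_arcsD1 K.in_arcsD2)
  moreover have "dominating_set K (Z \<inter> pverts K)"
    using Z(1) disj unfolding dominating_set_def verts arcs
    by (blast dest: K.in_arcsD1 H.in_arcsD2)
  ultimately have "domination_number H + domination_number K
      \<le> card (Z \<inter> pverts H) + card (Z \<inter> pverts K)"
    by (intro add_mono domination_number_le)
  also have "\<dots> = card (Z \<inter> pverts H \<union> Z \<inter> pverts K)"
    using fin disj verts by (intro card_Un_disjoint[symmetric]) auto
  also have "Z \<inter> pverts H \<union> Z \<inter> pverts K = Z"
    using Z(1) by (auto simp: dominating_set_def verts)
  finally show "domination_number H + domination_number K \<le> domination_number G"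
    using Z(2) by simp
qed

section \<open>Connectedness and domination number of paths\<close>

lemma pair_graph_path_graph: "pair_graph (path_graph n)"
proof
  have "parcs (path_graph n) \<subseteq> {..<n} \<times> {..<n}"
    by (auto simp: path_graph_def)
  then show "finite (parcs (path_graph n))"
    by (rule finite_subset) simp
qed (auto simp: path_graph_def symmetric_def intro: symI)

lemma connected_path_graph:
  assumes "0 < n"
  shows "Digraph_Component.connected (with_proj (path_graph n))"
proof -
  interpret pair_graph "path_graph n" by (rule pair_graph_path_graph)
  have from0: "0 \<rightarrow>\<^sup>*\<^bsub>with_proj (path_graph n)\<^esub> v" if "v < n" for v
    using that
  proof (induction v)
    case 0
    then show ?case by (intro reachable_refl) (simp add: path_graph_def)
  next
    case (Suc v)
    then have "(v, Suc v) \<in> parcs (path_graph n)"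
      by (simp add: path_graph_def)
    with Suc.IH[OF Suc_lessD[OF Suc.prems]] show ?case
      by (rule reachable_adj_trans)
  qed
  \<comment> \<open>By symmetry of the arc set, \<open>u\<close> reaches 0, and from there one
    climbs to \<open>v\<close>. The library's \<open>connected\<close> asks for strong connectivity
    of the symmetric closure, hence the transfer to \<open>mk_symmetric\<close> next.\<close>
  have "u \<rightarrow>\<^sup>*\<^bsub>with_proj (path_graph n)\<^esub> v" if "u < n" "v < n" for u v
    using from0[OF that(1)] from0[OF that(2)] by (meson reachable_trans symmetric_reachable')
  then have "u \<rightarrow>\<^sup>*\<^bsub>with_proj (mk_symmetric (with_proj (path_graph n)))\<^esub> v"
    if "u < n" "v < n" for u v
    using that by (intro reachable_mk_symmetricI) simp
  then show ?thesis
    unfolding connected_def using assms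
    by (intro strongly_connectedI) (auto simp: path_graph_def mk_symmetric_def)
qed

lemma domination_number_path_graph: "domination_number (path_graph n) = (n + 2) div 3"
proof (rule antisym)
  \<comment> \<open>Cut the path into blocks of three consecutive vertices and take the middle of
    each. The \<open>min\<close> matters only for a last block of a single vertex, whose would-be
    middle is \<open>n\<close>.\<close>
  define X where "X = (\<lambda>k. min (3 * k + 1) (n - 1)) ` {..<(n + 2) div 3}"
  have "dominating_set (path_graph n) X"
    unfolding dominating_set_def
  proof (intro conjI ballI)
    show "X \<subseteq> pverts (path_graph n)"
      by (auto simp: X_def path_graph_def)
  next
    fix v
    assume "v \<in> pverts (path_graph n)"
    then have v: "v < n"
      by (simp add: path_graph_def)
    let ?x = "min (3 * (v div 3) + 1) (n - 1)"
    have "v div 3 < (n + 2) div 3"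
      using v div_le_mono[of "v + 3" "n + 2" 3] by simp
    then have "?x \<in> X"
      unfolding X_def by blast
    moreover have "v = ?x \<or> v = Suc ?x \<or> ?x = Suc v"
    proof -
      have "v = 3 * (v div 3) + v mod 3" "v mod 3 < 3"
        by simp_all
      then show ?thesis
        using v by linarith
    qed
    then have "v = ?x \<or> (?x, v) \<in> parcs (path_graph n)"
      using v by (auto simp: path_graph_def)
    ultimately show "v \<in> X \<or> (\<exists>x\<in>X. (x, v) \<in> parcs (path_graph n))"
      by metis
  qed
  then have "domination_number (path_graph n) \<le> card X"
    by (rule domination_number_le)
  also have "\<dots> \<le> (n + 2) div 3"
    unfolding X_def using card_image_le[OF finite_lessThan] by (metis card_lessThan)
  finally show "domination_number (path_graph n) \<le> (n + 2) div 3" .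
next
  obtain X where X: "dominating_set (path_graph n) X" "card X = domination_number (path_graph n)"
    by (rule obtain_minimum_dominating_set)
  have "finite X"
    using X(1) by (auto simp: dominating_set_def path_graph_def intro: finite_subset)
  \<comment> \<open>Each triple covers the closed neighbourhood of \<open>x\<close>; truncated
    subtraction at \<open>x = 0\<close> only repeats 0. Counting gives \<open>n\<close> \<le>
    \<open>3 * card X\<close>.\<close>
  have "{..<n} \<subseteq> (\<Union>x\<in>X. {x - 1, x, Suc x})"
  proof
    fix v
    assume "v \<in> {..<n}"
    with X(1) have "v \<in> X \<or> (\<exists>x\<in>X. v = Suc x \<or> x = Suc v)"
      by (auto simp: dominating_set_def path_graph_def)
    then have "\<exists>x\<in>X. v = x - 1 \<or> v = x \<or> v = Suc x"
      by (metis diff_Suc_1)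
    then show "v \<in> (\<Union>x\<in>X. {x - 1, x, Suc x})"
      by simp
  qed
  then have "n \<le> card (\<Union>x\<in>X. {x - 1, x, Suc x})"
    using \<open>finite X\<close> by (metis (no_types, lifting) card_lessThan card_mono finite.emptyI
      finite.insertI finite_UN_I)
  also have "\<dots> \<le> (\<Sum>x\<in>X. card {x - 1, x, Suc x})"
    using \<open>finite X\<close> by (rule card_UN_le)
  also have "\<dots> \<le> (\<Sum>x\<in>X. 3)"
    by (intro sum_mono) (simp add: card_insert_if)
  finally show "(n + 2) div 3 \<le> domination_number (path_graph n)"
    using X(2) by simp
qed

section \<open>Deleting and subdividing an edge of a path\<close>

lemma domination_number_delete_edge_path_graph:
  assumes i: "Suc i < n"
  shows "domination_number (delete_edge (path_graph n) (i, Suc i))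
    = (i + 3) div 3 + (n - Suc i + 2) div 3"
proof -
  \<comment> \<open>The upper component keeps its labels here, so that the union is literally
    disjoint; it is shifted down to a standard path afterwards.\<close>
  define K where "K = \<lparr> pverts = {Suc i..<n},
    parcs = parcs (path_graph n) \<inter> {Suc i..<n} \<times> {Suc i..<n} \<rparr>"
  have "domination_number (delete_edge (path_graph n) (i, Suc i))
      = domination_number (path_graph (Suc i)) + domination_number K"
  proof (rule domination_number_disjoint_union)
    show "pair_wf_digraph (path_graph (Suc i))"
      by unfold_locales (auto simp: path_graph_def)
    show "pair_wf_digraph K"
      by unfold_locales (auto simp: K_def)
  qed (use i in \<open>auto simp: delete_edge_def path_graph_def K_def\<close>)
  also have "domination_number K = domination_number (path_graph (n - Suc i))"
  proof (rule domination_number_iso)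
    show "bij_betw (\<lambda>v. v - Suc i) (pverts K) (pverts (path_graph (n - Suc i)))"
      by (rule bij_betw_byWitness[where f' = "\<lambda>v. v + Suc i"])
        (auto simp: K_def path_graph_def)
  qed (auto simp: K_def path_graph_def)
  finally show ?thesis
    by (simp add: domination_number_path_graph)
qed

lemma domination_number_subdivide_edge_path_graph:
  assumes i: "Suc i < n"
  shows "domination_number (subdivide_edge (path_graph n) (i, Suc i)) = (n + 3) div 3"
proof -
  \<comment> \<open>The new vertex \<open>None\<close> takes position \<open>Suc i\<close>, and
    later vertices of the old path move up by one; \<open>g\<close> is the inverse
    relabelling.\<close>
  define f where
    "f v = (if v \<le> i then Some v else if v = Suc i then None else Some (v - 1))" for v
  define g where
    "g w = (case w of None \<Rightarrow> Suc i | Some v \<Rightarrow> if v \<le> i then v else Suc v)" for w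
  have "domination_number (path_graph (Suc n))
      = domination_number (subdivide_edge (path_graph n) (i, Suc i))"
  proof (rule domination_number_iso)
    show "bij_betw f (pverts (path_graph (Suc n)))
        (pverts (subdivide_edge (path_graph n) (i, Suc i)))"
      using i by (intro bij_betw_byWitness[where f' = g])
        (auto simp: f_def g_def path_graph_def subdivide_edge_def subdivide.simps)
  next
    fix u v
    assume "u \<in> pverts (path_graph (Suc n))" "v \<in> pverts (path_graph (Suc n))"
    then show "(f u, f v) \<in> parcs (subdivide_edge (path_graph n) (i, Suc i))
        \<longleftrightarrow> (u, v) \<in> parcs (path_graph (Suc n))"
      using i by (auto simp: f_def path_graph_def subdivide_edge_def subdivide.simps image_iff)
  qed
  then show ?thesis
    by (simp add: domination_number_path_graph)
qed

text \<open>An edge occurs as two arcs, but the counts above treat only \<open>(i, Suc i)\<close>.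
  The two swap facts carry them over to \<open>(Suc i, i)\<close>.\<close>

lemma delete_edge_swap: "delete_edge G (v, u) = delete_edge G (u, v)"
  by (simp add: delete_edge_def insert_commute)

lemma subdivide_edge_swap: "subdivide_edge G (v, u) = subdivide_edge G (u, v)"
  by (auto simp: subdivide_edge_def subdivide.simps)

lemma SR_graph_path_graph_iff:
  assumes "2 \<le> n"
  shows "SR_graph (path_graph n) \<longleftrightarrow>
    (\<forall>i. Suc i < n \<longrightarrow> (i + 3) div 3 + (n - Suc i + 2) div 3 = (n + 3) div 3)"
proof -
  let ?P = "\<lambda>e. domination_number (delete_edge (path_graph n) e)
    = domination_number (subdivide_edge (path_graph n) e)"
  have "SR_graph (path_graph n) \<longleftrightarrow> (\<forall>e\<in>parcs (path_graph n). ?P e)"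
    using assms pair_graph_path_graph connected_path_graph[of n]
    by (simp add: SR_graph_def) (simp add: path_graph_def)
  also have "\<dots> \<longleftrightarrow> (\<forall>i. Suc i < n \<longrightarrow> ?P (i, Suc i))"
  proof (intro iffI ballI)
    fix e
    assume *: "\<forall>i. Suc i < n \<longrightarrow> ?P (i, Suc i)" and "e \<in> parcs (path_graph n)"
    then consider i where "Suc i < n" "e = (i, Suc i)" | i where "Suc i < n" "e = (Suc i, i)"
      by (auto simp: path_graph_def)
    then show "?P e"
      using * by cases (simp_all add: delete_edge_swap[of _ "Suc _"] subdivide_edge_swap[of _ "Suc _"])
  qed (simp add: path_graph_def)
  also have "\<dots> \<longleftrightarrow>
      (\<forall>i. Suc i < n \<longrightarrow> (i + 3) div 3 + (n - Suc i + 2) div 3 = (n + 3) div 3)"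
    by (simp add: domination_number_delete_edge_path_graph
        domination_number_subdivide_edge_path_graph cong: imp_cong)
  finally show ?thesis .
qed

section \<open>Arithmetic of rounded-up thirds\<close>

text \<open>Here \<open>i + 1\<close> and \<open>m\<close> are the orders of the two pieces of a
  path of order \<open>3 * t + 1\<close>. Their residues mod 3 are (1,0), (2,2) or (0,1), and in
  each case rounding both up to multiples of 3 adds 2 in total, giving
  \<open>3 * t + 3\<close>.\<close>

lemma ceiling_thirds_add:
  fixes i m t :: nat
  assumes t: "i + m = 3 * t"
  shows "(i + 3) div 3 + (m + 2) div 3 = t + 1"
proof -
  have "i = 3 * (i div 3) + i mod 3" "i mod 3 < 3"
    by simp_all
  then obtain a r where i: "i = 3 * a + r" and "r < 3" by blast
  then consider "r = 0" | "r = 1" | "r = 2" by linarith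
  then show ?thesis
  proof cases
    case 1
    with t i have "m = 3 * (t - a)" "a \<le> t" by linarith+
    then show ?thesis using 1 i by simp
  next
    case 2
    with t i have "m = 3 * (t - a - 1) + 2" "a < t" by linarith+
    then show ?thesis using 2 i by simp
  next
    case 3
    with t i have "m = 3 * (t - a - 1) + 1" "a < t" by linarith+
    then show ?thesis using 3 i by simp
  qed
qed

theorem proposition2:
  fixes n :: nat
  assumes "2 \<le> n"
  shows "SR_graph (path_graph n) \<longleftrightarrow> n = 3 \<or> (4 \<le> n \<and> [n = 1] (mod 3))"
  unfolding SR_graph_path_graph_iff[OF assms]
proof
  assume *: "\<forall>i. Suc i < n \<longrightarrow> (i + 3) div 3 + (n - Suc i + 2) div 3 = (n + 3) div 3"
  \<comment> \<open>The test edges split off one vertex (\<open>i = 0\<close>) and then three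
    vertices (\<open>i = 2\<close>); the second edge exists only for \<open>3 < n\<close>.\<close>
  have "n mod 3 \<noteq> 2"
    using *[rule_format, of 0] assms by simp presburger
  moreover have "n mod 3 \<noteq> 0" if "3 < n"
    using *[rule_format, of 2] that by simp presburger
  ultimately show "n = 3 \<or> (4 \<le> n \<and> [n = 1] (mod 3))"
    unfolding cong_def using assms by presburger
next
  assume *: "n = 3 \<or> (4 \<le> n \<and> [n = 1] (mod 3))"
  show "\<forall>i. Suc i < n \<longrightarrow> (i + 3) div 3 + (n - Suc i + 2) div 3 = (n + 3) div 3"
  proof (intro allI impI)
    fix i
    assume i: "Suc i < n"
    show "(i + 3) div 3 + (n - Suc i + 2) div 3 = (n + 3) div 3"
    proof (cases "n = 3")
      case True
      \<comment> \<open>Either edge leaves pieces of orders 1 and 2, with sum 1 + 1 = 2, which is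
        also the value for the path of order 4.\<close>
      with i have "i = 0 \<or> i = 1"
        by linarith
      with True show ?thesis
        by auto
    next
      case False
      with * have "n mod 3 = 1"
        by (simp add: cong_def)
      then obtain t where t: "n = 3 * t + 1"
        by (metis mult_div_mod_eq)
      moreover obtain m where m: "n = Suc (i + m)"
        using i less_imp_Suc_add by fastforce
      ultimately have "i + m = 3 * t"
        by simp
      then have "(i + 3) div 3 + (m + 2) div 3 = t + 1"
        by (rule ceiling_thirds_add)
      moreover have "(n + 3) div 3 = t + 1" "n - Suc i = m"
        using t m by simp_all
      ultimately show ?thesis
        by simp
    qed
  qed
qed

end
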